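(* Let $G$ be a connected, non-complete $(v,k,\lambda,\mu)$-SRG that is the point graph of a finite $\Delta$-space of order $(s,t)$. If $\mu(s+1)/s<k$ and $s\geq 2$, then $G$ is a counterexample to Brouwer's Conjecture; that is, there is a disconnecting set $S$ of $G$ such that every component of $G\setminus S$ has at least two vertices and $|S|<2k-\lambda-2$.
   Context: All graphs are finite and simple. A graph $G$ is a $(v,k,\lambda,\mu)$-SRG (strongly regular graph) if it has $v$ vertices, is $k$-regular, any two adjacent vertices have exactly $\lambda$ common neighbors, and any two distinct non-adjacent vertices have exactly $\mu$ common neighbors. A disconnecting set of a connected graph $G$ is a set $S$ of vertices such that $G\setminus S$ is disconnected. Brouwer's Conjecture asserts that if $G$ is a connected $(v,k,\lambda,\mu)$-SRG and $S$ is a disconnecting set of $G$ whose removal disconnects $G$ into non-singleton components, then $|S|\geq 2k-\lambda-2$. A partial linear space is a pair $(P,L)$ with $L\subseteq 2^P$ (elements of $P$ are points, elements of $L$ are lines) such that every line contains at least two points and any two distinct points lie on at most one common line. Two distinct points are collinear if some line contains both. A $\Delta$-space is a partial linear space such that for every point $p$ and line $\ell$ with $p\notin\ell$, $p$ is collinear with none, all but one, or all of the points of $\ell$. A partial linear space has order $(s,t)$ if every line contains exactly $s+1$ points and every point is on exactly $t+1$ lines. The point graph has vertex set $P$, with two distinct points adjacent if and only if they are collinear. *)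

theory Defs
  imports Complex_Main "Graph_Theory.Graph_Theory"
begin

text \<open>
  A finite simple graph is a symmetric digraph in the sense of \<^locale>\<open>graph\<close> (finite, no loops,
  no parallel arcs, every edge present in both directions). Hence the degree of a vertex
  is its \<^const>\<open>out_degree\<close>, and the connected components are the members of
  \<^const>\<open>pre_digraph.sccs\<close>.
\<close>

definition common_neighbors :: "('a, 'b) pre_digraph \<Rightarrow> 'a \<Rightarrow> 'a \<Rightarrow> 'a set" where
  "common_neighbors G x y = {z \<in> verts G. x \<rightarrow>\<^bsub>G\<^esub> z \<and> y \<rightarrow>\<^bsub>G\<^esub> z}"

definition strongly_regular ::
    "('a, 'b) pre_digraph \<Rightarrow> nat \<Rightarrow> nat \<Rightarrow> nat \<Rightarrow> nat \<Rightarrow> bool" where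
  "strongly_regular G v k lam mu \<longleftrightarrow>
     graph G \<and>
     card (verts G) = v \<and>
     (\<forall>x\<in>verts G. out_degree G x = k) \<and>
     (\<forall>x\<in>verts G. \<forall>y\<in>verts G. x \<rightarrow>\<^bsub>G\<^esub> y \<longrightarrow> card (common_neighbors G x y) = lam) \<and>
     (\<forall>x\<in>verts G. \<forall>y\<in>verts G. x \<noteq> y \<longrightarrow> \<not> x \<rightarrow>\<^bsub>G\<^esub> y \<longrightarrow>
        card (common_neighbors G x y) = mu)"

definition delete_verts :: "('a, 'b) pre_digraph \<Rightarrow> 'a set \<Rightarrow> ('a, 'b) pre_digraph" where
  "delete_verts G S = G \<restriction> (verts G - S)"

text \<open>
  The library does not count the empty graph as \<^const>\<open>connected\<close>. It is not disconnected either,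
  so the set of all vertices is never a disconnecting set.
\<close>

definition disconnecting_set :: "('a, 'b) pre_digraph \<Rightarrow> 'a set \<Rightarrow> bool" where
  "disconnecting_set G S \<longleftrightarrow>
     S \<subseteq> verts G \<and> verts (delete_verts G S) \<noteq> {} \<and> \<not> connected (delete_verts G S)"

definition partial_linear_space :: "'a set \<Rightarrow> 'a set set \<Rightarrow> bool" where
  "partial_linear_space P L \<longleftrightarrow>
     L \<subseteq> Pow P \<and>
     (\<forall>l\<in>L. \<exists>p\<in>l. \<exists>q\<in>l. p \<noteq> q) \<and>
     (\<forall>p\<in>P. \<forall>q\<in>P. p \<noteq> q \<longrightarrow>
        (\<forall>l\<in>L. \<forall>m\<in>L. p \<in> l \<and> q \<in> l \<and> p \<in> m \<and> q \<in> m \<longrightarrow> l = m))"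

definition collinear_in :: "'a set set \<Rightarrow> 'a \<Rightarrow> 'a \<Rightarrow> bool" where
  "collinear_in L p q \<longleftrightarrow> p \<noteq> q \<and> (\<exists>l\<in>L. p \<in> l \<and> q \<in> l)"

definition delta_space :: "'a set \<Rightarrow> 'a set set \<Rightarrow> bool" where
  "delta_space P L \<longleftrightarrow>
     partial_linear_space P L \<and>
     (\<forall>p\<in>P. \<forall>l\<in>L. p \<notin> l \<longrightarrow>
        (\<forall>q\<in>l. \<not> collinear_in L p q) \<or>
        (\<exists>!q. q \<in> l \<and> \<not> collinear_in L p q) \<or>
        (\<forall>q\<in>l. collinear_in L p q))"

definition has_order :: "'a set \<Rightarrow> 'a set set \<Rightarrow> nat \<Rightarrow> nat \<Rightarrow> bool" where
  "has_order P L s t \<longleftrightarrow>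
     (\<forall>l\<in>L. card l = s + 1) \<and> (\<forall>p\<in>P. card {l \<in> L. p \<in> l} = t + 1)"

definition point_graph :: "'a set \<Rightarrow> 'a set set \<Rightarrow> 'a pair_pre_digraph" where
  "point_graph P L =
     \<lparr> pverts = P, parcs = {(p, q). p \<in> P \<and> q \<in> P \<and> collinear_in L p q} \<rparr>"

end

(*
  Removing the neighbourhood S of a line l cuts l off from the rest of the graph. In a Delta-space
  every point of S misses at most one point of l, so for two points x, y of l the set S is the
  union of its intersections with N(x) and N(y); counting gives |S| = 2k - lambda - 1 - s.
  A point w outside l and S cannot have all its neighbours in S: each of them would be adjacent
  to at least s points of l, while w has only mu common neighbours with each point of l, so that
  k s <= mu (s + 1). Finally, if there were no such point w and x in l had a non-neighbour, then
  all non-neighbours of x would lie in S, and there are k - lambda - 1 of them. This is also the number of non-neighbours of x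
  adjacent to a given neighbour of x, so N(x) lies in the neighbourhood of every
  non-neighbour of x, and mu = k.
*)

theory Submission
  imports Defs
begin

section \<open>Deleting vertices from a graph\<close>

text \<open>In a symmetric digraph connectedness gives a walk from \<open>a\<close> to
  \<open>b\<close>. It starts in \<open>A\<close> and, avoiding \<open>S\<close>, can never leave
  \<open>A\<close>. Below, \<open>A\<close> is a line.\<close>

lemma (in sym_digraph) not_connected_delete_verts:
  assumes "a \<in> A" "A \<subseteq> verts G - S" "b \<in> verts G - S - A"
    and closed: "\<And>u v. u \<in> A \<Longrightarrow> u \<rightarrow> v \<Longrightarrow> v \<in> A \<union> S"
  shows "\<not> connected (delete_verts G S)"
proof
  let ?H = "delete_verts G S"
  have ind: "induced_subgraph ?H G"
    unfolding delete_verts_def by (rule induced_induce) simp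
  interpret H: sym_digraph ?H by (rule induced_graph_imp_graph[OF ind])
  assume "connected ?H"
  then have "strongly_connected ?H"
    by (rule H.symmetric_connected_imp_strongly_connected[OF H.sym_arcs])
  then have "a \<rightarrow>\<^sup>*\<^bsub>?H\<^esub> b"
    using assms(1-3) by (auto simp: strongly_connected_def delete_verts_def)
  then have "b \<in> A"
  proof (induction rule: H.reachable_induct)
    case base
    show ?case by (rule assms(1))
  next
    case (step u v)
    from step.hyps have "u \<rightarrow> v" "v \<notin> S"
      using adj_mono[OF _ induced_imp_subgraph[OF ind]] H.adj_in_verts(2)[of u v]
      by (auto simp: delete_verts_def)
    then show ?case using closed step.IH by blast
  qed
  with assms(3) show False by blast
qed

text \<open>By symmetry a neighbour of \<open>u\<close> lies in the strong component of
  \<open>u\<close>, and it differs from \<open>u\<close> because there are no loops.\<close>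

lemma card_verts_sccs_ge_2:
  assumes "sym_digraph H" "digraph H"
    and nbr: "\<And>u. u \<in> verts H \<Longrightarrow> \<exists>v. u \<rightarrow>\<^bsub>H\<^esub> v"
    and C: "C \<in> pre_digraph.sccs H"
  shows "card (verts C) \<ge> 2"
proof -
  interpret sym_digraph H by (rule assms)
  interpret digraph H by (rule assms)
  have C': "verts C \<in> sccs_verts" using in_sccs_vertsI_sccs C by blast
  then obtain u where u: "u \<in> verts C" unfolding sccs_verts_def by blast
  have sub: "verts C \<subseteq> verts H"
    using in_sccs_imp_induced[OF C] by auto
  obtain v where uv: "u \<rightarrow>\<^bsub>H\<^esub> v" using nbr u sub by blast
  have "v \<rightarrow>\<^bsub>H\<^esub> u" using uv graph_symmetric by blast
  with uv have "v \<in> verts C" using C' u unfolding sccs_verts_def by blast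
  moreover have "u \<noteq> v" using uv adj_not_same by blast
  moreover have "finite (verts C)" using sub finite_verts finite_subset by blast
  ultimately show ?thesis
    using card_mono[of "verts C" "{u, v}"] u by simp
qed

section \<open>The neighbourhood of a line\<close>

definition nbrs :: "'a set \<Rightarrow> 'a set set \<Rightarrow> 'a \<Rightarrow> 'a set" where
  "nbrs P L x = {y \<in> P. collinear_in L x y}"

text \<open>The future disconnecting set. Points of \<open>l\<close> are neighbours of each other,
  so they have to be taken out of the union.\<close>

definition line_nbrs :: "'a set \<Rightarrow> 'a set set \<Rightarrow> 'a set \<Rightarrow> 'a set" where
  "line_nbrs P L l = (\<Union>x\<in>l. nbrs P L x) - l"

lemma collinear_in_sym: "collinear_in L x y \<longleftrightarrow> collinear_in L y x"
  unfolding collinear_in_def by blast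

lemma collinear_in_irrefl: "\<not> collinear_in L x x"
  unfolding collinear_in_def by blast

text \<open>Strong regularity is restated through \<open>nbrs\<close>, so that all counting happens
  in plain finite sets.\<close>

locale srg_delta_space =
  fixes P :: "'a set" and L :: "'a set set" and s k lam mu :: nat
  assumes finite_points: "finite P"
    and delta: "delta_space P L"
    and card_line: "l \<in> L \<Longrightarrow> card l = s + 1"
    and degree: "x \<in> P \<Longrightarrow> card (nbrs P L x) = k"
    and common_collinear: "\<lbrakk>x \<in> P; y \<in> P; collinear_in L x y\<rbrakk> \<Longrightarrow>
      card (nbrs P L x \<inter> nbrs P L y) = lam"
    and common_noncollinear: "\<lbrakk>x \<in> P; y \<in> P; x \<noteq> y; \<not> collinear_in L x y\<rbrakk> \<Longrightarrow>
      card (nbrs P L x \<inter> nbrs P L y) = mu"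
begin

abbreviation N :: "'a \<Rightarrow> 'a set" where "N \<equiv> nbrs P L"
abbreviation S :: "'a set \<Rightarrow> 'a set" where "S \<equiv> line_nbrs P L"

lemma finite_N: "finite (N x)"
  using finite_points by (simp add: nbrs_def)

lemma line_subset: "l \<in> L \<Longrightarrow> l \<subseteq> P"
  using delta by (auto simp: delta_space_def partial_linear_space_def)

lemma finite_line: "l \<in> L \<Longrightarrow> finite l"
  using line_subset finite_points finite_subset by blast

lemma S_subset: "S l \<subseteq> P"
  by (auto simp: line_nbrs_def nbrs_def)

lemma finite_S: "finite (S l)"
  using S_subset finite_points finite_subset by blast

lemma N_sym: "\<lbrakk>x \<in> P; y \<in> N x\<rbrakk> \<Longrightarrow> x \<in> N y"
  by (simp add: nbrs_def collinear_in_sym)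

lemma N_irrefl: "x \<notin> N x"
  by (simp add: nbrs_def collinear_in_irrefl)

lemma line_subset_N: "\<lbrakk>l \<in> L; x \<in> l\<rbrakk> \<Longrightarrow> l - {x} \<subseteq> N x"
  using line_subset by (auto simp: nbrs_def collinear_in_def)

lemma N_subset: "\<lbrakk>l \<in> L; x \<in> l\<rbrakk> \<Longrightarrow> N x \<subseteq> S l \<union> (l - {x})"
  using N_irrefl by (auto simp: line_nbrs_def)

text \<open>Being in \<open>S l\<close>, the point \<open>u\<close> is collinear with some point of
  \<open>l\<close>. This excludes the case "none" of the Delta axiom.\<close>

lemma S_misses_at_most_one:
  assumes "l \<in> L" "u \<in> S l" "x \<in> l" "y \<in> l" "u \<notin> N x" "u \<notin> N y"
  shows "x = y"
proof -
  have u: "u \<in> P" "u \<notin> l" "\<exists>z\<in>l. collinear_in L u z"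
    using assms(2) by (auto simp: line_nbrs_def nbrs_def collinear_in_sym)
  have nc: "\<not> collinear_in L u x" "\<not> collinear_in L u y"
    using assms u by (auto simp: nbrs_def collinear_in_sym)
  from delta u(1,2) assms(1) have "(\<forall>q\<in>l. \<not> collinear_in L u q) \<or>
      (\<exists>!q. q \<in> l \<and> \<not> collinear_in L u q) \<or> (\<forall>q\<in>l. collinear_in L u q)"
    unfolding delta_space_def by blast
  then show ?thesis using u(3) nc assms(3,4) by blast
qed

section \<open>Counting in the neighbourhood of a line\<close>

lemma card_N_Int_S:
  assumes "l \<in> L" "x \<in> l"
  shows "k = card (N x \<inter> S l) + s"
proof -
  have "N x = (N x \<inter> S l) \<union> (l - {x})"
    using N_subset[OF assms] line_subset_N[OF assms] by blast
  moreover have "(N x \<inter> S l) \<inter> (l - {x}) = {}" by (auto simp: line_nbrs_def)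
  ultimately have "card (N x) = card (N x \<inter> S l) + card (l - {x})"
    using card_Un_disjoint finite_N finite_line[OF assms(1)] by (metis finite_Diff finite_Int)
  moreover have "card (l - {x}) = s"
    using card_line assms finite_line by simp
  ultimately show ?thesis using degree line_subset assms by fastforce
qed

text \<open>The common neighbours of \<open>x\<close> and \<open>y\<close> are those in
  \<open>S l\<close> and the \<open>s - 1\<close> other points of \<open>l\<close>. The
  \<open>1\<close> is moved to the left to avoid subtraction of naturals.\<close>

lemma card_common_Int_S:
  assumes "l \<in> L" "x \<in> l" "y \<in> l" "x \<noteq> y"
  shows "lam + 1 = card (N x \<inter> N y \<inter> S l) + s"
proof -
  have "N x \<inter> N y = (N x \<inter> N y \<inter> S l) \<union> (l - {x, y})"
    using N_subset[OF assms(1,2)] N_subset[OF assms(1,3)]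
      line_subset_N[OF assms(1,2)] line_subset_N[OF assms(1,3)] by blast
  moreover have "(N x \<inter> N y \<inter> S l) \<inter> (l - {x, y}) = {}" by (auto simp: line_nbrs_def)
  ultimately have "card (N x \<inter> N y) = card (N x \<inter> N y \<inter> S l) + card (l - {x, y})"
    using card_Un_disjoint finite_N finite_line[OF assms(1)] by (metis finite_Diff finite_Int)
  moreover have "card (l - {x, y}) + 2 = s + 1"
    using card_Diff_subset[of "{x, y}" l] card_line[OF assms(1)] finite_line[OF assms(1)] assms
      card_mono[of l "{x, y}"]
    by simp
  moreover have "card (N x \<inter> N y) = lam"
    using assms line_subset by (intro common_collinear) (auto simp: collinear_in_def)
  ultimately show ?thesis by linarith
qed

text \<open>No point of \<open>S l\<close> misses both \<open>x\<close> and \<open>y\<close>, so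
  their neighbourhoods cover \<open>S l\<close>. Inclusion-exclusion gives 2(k - s) - (lam + 1 -
  s).\<close>

lemma card_S:
  assumes "l \<in> L" "x \<in> l" "y \<in> l" "x \<noteq> y"
  shows "card (S l) + lam + 1 + s = 2 * k"
proof -
  have "S l = (N x \<inter> S l) \<union> (N y \<inter> S l)"
    using S_misses_at_most_one[OF assms(1) _ assms(2,3)] assms(4) by blast
  moreover have "(N x \<inter> S l) \<inter> (N y \<inter> S l) = N x \<inter> N y \<inter> S l" by blast
  ultimately have "card (N x \<inter> S l) + card (N y \<inter> S l) = card (S l) + card (N x \<inter> N y \<inter> S l)"
    using card_Un_Int[of "N x \<inter> S l" "N y \<inter> S l"] finite_N by (metis finite_Int)
  then show ?thesis
    using card_N_Int_S[OF assms(1,2)] card_N_Int_S[OF assms(1,3)] card_common_Int_S[OF assms]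
    by linarith
qed

lemma card_S_minus_N:
  assumes "l \<in> L" "x \<in> l" "y \<in> l" "x \<noteq> y"
  shows "card (S l - N x) + lam + 1 = k"
proof -
  have "card (S l) = card (S l - N x) + card (N x \<inter> S l)"
    using card_Diff_subset_Int[of "S l" "N x"] finite_S[of l] card_mono[of "S l" "S l \<inter> N x"]
    by (simp add: Int_commute)
  then show ?thesis using card_S[OF assms] card_N_Int_S[OF assms(1,2)] by linarith
qed

section \<open>Points away from the line and its neighbourhood\<close>

lemma card_N_minus_N:
  assumes "x \<in> P" "u \<in> N x"
  shows "card (N u - N x - {x}) + lam + 1 = k"
proof -
  have u: "u \<in> P" "x \<in> N u" using assms N_sym by (auto simp: nbrs_def)
  have "N u = (N u - N x - {x}) \<union> insert x (N x \<inter> N u)" using u by blast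
  moreover have "card ((N u - N x - {x}) \<union> insert x (N x \<inter> N u)) =
      card (N u - N x - {x}) + card (insert x (N x \<inter> N u))"
    by (rule card_Un_disjoint) (auto simp: finite_N)
  moreover have "card (insert x (N x \<inter> N u)) = lam + 1"
    using N_irrefl[of x] finite_N common_collinear[of x u] u(1) assms by (simp add: nbrs_def)
  ultimately show ?thesis using degree[OF u(1)] by simp
qed

text \<open>Provides a vertex on the far side of the separation.\<close>

lemma exists_outside:
  assumes "l \<in> L" "x \<in> l" "y \<in> l" "x \<noteq> y"
    and w: "w \<in> P" "w \<noteq> x" "w \<notin> N x" and "mu \<noteq> k"
  shows "\<exists>z\<in>P. z \<notin> l \<union> S l"
proof (rule ccontr)
  assume "\<not> ?thesis"
  then have all: "P \<subseteq> l \<union> S l" by blast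
  have x: "x \<in> P" using line_subset assms by blast
  then have nonnbrs: "P - N x - {x} = S l - N x"
    using all S_subset line_subset_N[OF assms(1,2)] assms(2) by (auto simp: line_nbrs_def)
  have "N x \<subseteq> N w"
  proof
    fix u assume u: "u \<in> N x"
    \<comment> \<open>Both sides are k - lam - 1. With the obvious inclusion this makes
      \<open>u\<close> adjacent to every non-neighbour of \<open>x\<close>, in particular to
      \<open>w\<close>.\<close>
    have "card (N u - N x - {x}) = card (P - N x - {x})"
      using card_N_minus_N[OF x u] card_S_minus_N[OF assms(1-4)] nonnbrs by simp
    then have "N u - N x - {x} = P - N x - {x}"
      using finite_points by (intro card_subset_eq) (auto simp: nbrs_def)
    then have "w \<in> N u" using w by blast
    then show "u \<in> N w" using N_sym u by (auto simp: nbrs_def)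
  qed
  then have "N x \<inter> N w = N x" by blast
  moreover have "card (N x \<inter> N w) = mu"
    using common_noncollinear[of x w] x w by (auto simp: nbrs_def)
  ultimately show False using degree[OF x] \<open>mu \<noteq> k\<close> by simp
qed

text \<open>Double counting of the adjacent pairs of a point \<open>u\<close> of \<open>N w\<close>
  and a point \<open>x\<close> of \<open>l\<close>: each \<open>u\<close> is in at least
  \<open>s\<close> pairs, each \<open>x\<close> in exactly \<open>mu\<close>.\<close>

lemma degree_bound_if_N_subset_S:
  assumes "l \<in> L" and w: "w \<in> P" "w \<notin> l \<union> S l" and sub: "N w \<subseteq> S l"
  shows "k * s \<le> mu * (s + 1)"
proof -
  have fl: "finite l" by (rule finite_line[OF assms(1)])
  have "s \<le> card {x \<in> l. u \<in> N x}" if "u \<in> N w" for u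
  proof -
    \<comment> \<open>As \<open>u\<close> lies in \<open>S l\<close>, it misses at most one of the s
      + 1 points of \<open>l\<close>.\<close>
    have "\<forall>x\<in>{x \<in> l. u \<notin> N x}. \<forall>y\<in>{x \<in> l. u \<notin> N x}. x = y"
      using S_misses_at_most_one[OF assms(1)] that sub by blast
    then have "card {x \<in> l. u \<notin> N x} \<le> 1"
      using card_le_Suc0_iff_eq[of "{x \<in> l. u \<notin> N x}"] fl by simp
    moreover have "{x \<in> l. u \<in> N x} = l - {x \<in> l. u \<notin> N x}" by blast
    ultimately show ?thesis
      using card_line[OF assms(1)] fl by (simp add: card_Diff_subset)
  qed
  then have "k * s \<le> (\<Sum>u\<in>N w. card {x \<in> l. u \<in> N x})"
    using sum_bounded_below[of "N w" s "\<lambda>u. card {x \<in> l. u \<in> N x}"] degree[OF w(1)] by simp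
  also have "\<dots> = (\<Sum>x\<in>l. card {u \<in> N w. u \<in> N x})"
    by (rule sum_multicount_gen[OF finite_N fl]) simp
  also have "\<dots> = (\<Sum>x\<in>l. mu)"
  proof (rule sum.cong[OF refl])
    fix x assume x: "x \<in> l"
    then have "x \<in> P" using line_subset assms(1) by blast
    moreover have "w \<noteq> x" "\<not> collinear_in L w x"
      using w x by (auto simp: line_nbrs_def nbrs_def collinear_in_sym)
    ultimately have "card (N w \<inter> N x) = mu" using common_noncollinear w(1) by blast
    moreover have "{u \<in> N w. u \<in> N x} = N w \<inter> N x" by blast
    ultimately show "card {u \<in> N w. u \<in> N x} = mu" by simp
  qed
  also have "\<dots> = mu * (s + 1)" using card_line[OF assms(1)] by simp
  finally show ?thesis .
qed

end

section \<open>The counterexample\<close>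

lemma adj_point_graph:
  "x \<rightarrow>\<^bsub>with_proj (point_graph P L)\<^esub> y \<longleftrightarrow> x \<in> P \<and> y \<in> nbrs P L x"
  by (auto simp: point_graph_def nbrs_def)

lemma verts_point_graph: "verts (with_proj (point_graph P L)) = P"
  by (simp add: point_graph_def)

lemma out_degree_point_graph:
  assumes "x \<in> P"
  shows "out_degree (with_proj (point_graph P L)) x = card (nbrs P L x)"
proof -
  have "out_arcs (with_proj (point_graph P L)) x = Pair x ` nbrs P L x"
    using assms by (auto simp: out_arcs_def point_graph_def nbrs_def)
  then show ?thesis by (simp add: out_degree_def card_image inj_on_def)
qed

lemma common_neighbors_point_graph:
  assumes "x \<in> P" "y \<in> P"
  shows "common_neighbors (with_proj (point_graph P L)) x y = nbrs P L x \<inter> nbrs P L y"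
  using assms by (auto simp: common_neighbors_def point_graph_def nbrs_def)

theorem mainTheorem7:
  fixes G :: "('a, 'a \<times> 'a) pre_digraph"
    and P :: "'a set" and L :: "'a set set"
    and v k lam mu s t :: nat
  assumes "strongly_regular G v k lam mu"
    and "connected G"
    and "\<not> K\<^bsub>card (verts G)\<^esub> G"
    and "finite P"
    and "delta_space P L"
    and "has_order P L s t"
    and "G = with_proj (point_graph P L)"
    and "real mu * (real s + 1) / real s < real k"
    and "s \<ge> 2"
  shows "\<exists>S. disconnecting_set G S \<and>
             (\<forall>C \<in> pre_digraph.sccs (delete_verts G S). card (verts C) \<ge> 2) \<and>
             int (card S) < 2 * int k - int lam - 2"
proof -
  note srg = assms(1)[unfolded strongly_regular_def]
  have adj: "x \<rightarrow>\<^bsub>G\<^esub> y \<longleftrightarrow> x \<in> P \<and> y \<in> nbrs P L x" for x y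
    unfolding assms(7) by (rule adj_point_graph)
  have verts: "verts G = P" unfolding assms(7) by (rule verts_point_graph)
  interpret G: graph G using srg by blast
  interpret srg_delta_space P L s k lam mu
  proof
    show "card (nbrs P L x) = k" if "x \<in> P" for x
      using srg that verts out_degree_point_graph[OF that] assms(7) by metis
    show "card (nbrs P L x \<inter> nbrs P L y) = lam" if "x \<in> P" "y \<in> P" "collinear_in L x y" for x y
    proof -
      have "x \<rightarrow>\<^bsub>G\<^esub> y" using that by (simp add: adj nbrs_def)
      then show ?thesis
        using srg that verts common_neighbors_point_graph[OF that(1,2)] assms(7) by metis
    qed
    show "card (nbrs P L x \<inter> nbrs P L y) = mu"
      if "x \<in> P" "y \<in> P" "x \<noteq> y" "\<not> collinear_in L x y" for x y
    proof -
      have "\<not> x \<rightarrow>\<^bsub>G\<^esub> y" using that by (simp add: adj nbrs_def)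
      then show ?thesis
        using srg that verts common_neighbors_point_graph[OF that(1,2)] assms(7) by metis
    qed
  qed (use assms(4-6) in \<open>auto simp: has_order_def\<close>)
  have bound: "mu * (s + 1) < k * s"
  proof -
    have "real mu * (real s + 1) < real k * real s"
      using assms(8,9) by (simp add: pos_divide_less_eq)
    then have "real (mu * (s + 1)) < real (k * s)" by (simp add: algebra_simps)
    then show ?thesis by (simp only: of_nat_less_iff)
  qed
  \<comment> \<open>For \<open>mu = k\<close> the bound would read k(s + 1) < ks.\<close>
  then have "mu \<noteq> k" by auto
  obtain x w where xw: "x \<in> P" "w \<in> P" "w \<noteq> x" "w \<notin> N x"
  proof -
    \<comment> \<open>The number of vertices is right by the choice of the index, so completeness
      can only fail in its condition on the arcs.\<close>
    have "arcs_ends G \<noteq> {(u, v). (u, v) \<in> verts G \<times> verts G \<and> u \<noteq> v}"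
      using assms(3) G.graph_axioms by (simp add: complete_digraph_def)
    moreover have "arcs_ends G = {(u, v). u \<in> P \<and> v \<in> N u}" using adj by auto
    moreover have "v \<in> P \<and> v \<noteq> u" if "v \<in> N u" for u v
      using that N_irrefl by (auto simp: nbrs_def)
    ultimately show ?thesis using that verts by blast
  qed
  \<comment> \<open>The line has to pass through a point with a non-neighbour for
    \<open>exists_outside\<close> to apply; t + 1 > 0 supplies one through \<open>x\<close>.\<close>
  have "card {l \<in> L. x \<in> l} = t + 1" using assms(6) xw(1) by (simp add: has_order_def)
  then have "{l \<in> L. x \<in> l} \<noteq> {}" by (metis Suc_eq_plus1 card.empty nat.distinct(1))
  then obtain l where l: "l \<in> L" "x \<in> l" by blast
  have ex_other: "\<exists>z\<in>l. z \<noteq> y" if "y \<in> l" for y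
    using delta l(1) unfolding delta_space_def partial_linear_space_def by metis
  obtain y where y: "y \<in> l" "x \<noteq> y" using ex_other[OF l(2)] by blast
  obtain b where b: "b \<in> P" "b \<notin> l \<union> S l"
    using exists_outside[OF l y xw(2-4) \<open>mu \<noteq> k\<close>] by blast
  let ?H = "delete_verts G (S l)"
  have lP: "l \<subseteq> P - S l" using line_subset[OF l(1)] by (auto simp: line_nbrs_def)
  have "\<not> connected ?H"
  proof (rule G.not_connected_delete_verts[OF l(2)])
    show "l \<subseteq> verts G - S l" "b \<in> verts G - S l - l" using lP b verts by auto
    show "v' \<in> l \<union> S l" if "u \<in> l" "u \<rightarrow>\<^bsub>G\<^esub> v'" for u v'
      using that N_subset[OF l(1)] adj by blast
  qed
  moreover have "verts ?H \<noteq> {}" using b verts by (auto simp: delete_verts_def)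
  ultimately have "disconnecting_set G (S l)"
    using S_subset verts by (simp add: disconnecting_set_def)
  moreover have "card (verts C) \<ge> 2" if C: "C \<in> pre_digraph.sccs ?H" for C
  proof (rule card_verts_sccs_ge_2[OF _ _ _ C])
    have ind: "induced_subgraph ?H G"
      unfolding delete_verts_def by (rule G.induced_induce) simp
    show "sym_digraph ?H" by (rule G.induced_graph_imp_graph[OF ind])
    show "digraph ?H" by (rule G.digraph_subgraph[OF induced_imp_subgraph[OF ind]])
    fix u assume "u \<in> verts ?H"
    then have u: "u \<in> P" "u \<notin> S l" using verts by (auto simp: delete_verts_def)
    \<comment> \<open>On the line, another point of \<open>l\<close> serves as \<open>z\<close>; off
      the line, \<open>N u\<close> inside \<open>S l\<close> would contradict
      \<open>bound\<close>.\<close>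
    have "\<exists>z \<in> N u. z \<notin> S l"
    proof (cases "u \<in> l")
      case True
      then obtain z where "z \<in> l" "z \<noteq> u" using ex_other by blast
      then show ?thesis using line_subset_N[OF l(1) True] lP by blast
    next
      case False
      then have "\<not> N u \<subseteq> S l"
        using degree_bound_if_N_subset_S[OF l(1) u(1)] u(2) bound by auto
      then show ?thesis by blast
    qed
    then obtain z where z: "z \<in> N u" "z \<notin> S l" by blast
    then have "u \<rightarrow>\<^bsub>G\<^esub> z" "z \<in> P" using u adj by (auto simp: nbrs_def)
    then have "u \<rightarrow>\<^bsub>?H\<^esub> z"
      using u z verts by (auto simp: delete_verts_def arcs_ends_conv)
    then show "\<exists>z. u \<rightarrow>\<^bsub>?H\<^esub> z" ..
  qed
  \<comment> \<open>The size is 2k - lam - 1 - s, which is at most 2k - lam - 3 since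
    \<open>s \<ge> 2\<close>.\<close>
  moreover have "int (card (S l)) < 2 * int k - int lam - 2"
    using card_S[OF l y] \<open>s \<ge> 2\<close> by linarith
  ultimately show ?thesis by blast
qed

end
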